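(* The following three identities hold: $$\sum_{k=1}^{\infty} \frac{16^k(6 k-1)(4 H_{2 k-1}-H_{k-1})}{(2 k-1) k^2\binom{2k}{k}\binom{4k}{2k}} =\pi^3,$$ $$\sum_{k=1}^{\infty} \frac{16^k \left( (6 k-1)(2 H_{4 k-1}-H_{2k-1}) + \frac{8k}{2k-1} \right) } {(2 k-1) k^2\binom{2k}{k}\binom{4k}{2k}} =\pi^3,$$ and $$\sum_{k=1}^{\infty} \frac{16^k \left( (6 k-1) H_{k-1}^{(2)} - \frac{8(4k-1)}{(2k-1)^2} \right) }{ (2 k-1) k^2\binom{2k}{k}\binom{4k}{2k}} =-32 \beta(4),$$ where $\beta(4) = \sum_{k=0}^\infty \frac{(-1)^k}{(2k+1)^4}$.
   Context: For integers $m\ge1$ and $n\ge0$, $H_n^{(m)}=\sum_{0<j\le n}\frac1{j^m}$ denotes the harmonic number of order $m$, and $H_n=H_n^{(1)}$ (so $H_0=H_0^{(m)}=0$). *)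

theory Defs
  imports "HOL-Analysis.Analysis"
begin

definition gen_harm :: "nat \<Rightarrow> nat \<Rightarrow> real" where
  "gen_harm m n = (\<Sum>j = 1..n. 1 / real j ^ m)"

text \<open>The order-one numbers are the library's \<^const>\<open>harm\<close>.\<close>

lemma gen_harm_1: "gen_harm 1 n = harm n"
  by (simp add: gen_harm_def harm_def inverse_eq_divide)

text \<open>Only positive integer arguments are covered; the series converges for every \<open>s \<ge> 1\<close>.\<close>

definition dirichlet_beta :: "nat \<Rightarrow> real" where
  "dirichlet_beta s = (\<Sum>k. (- 1) ^ k / real (2 * k + 1) ^ s)"

end

theory Submission
  imports Defs "HOL-Real_Asymp.Real_Asymp"
begin

text \<open>
  In terms of the Pochhammer symbol, the binomial factor of the \<open>(k+1)\<close>-st summand is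
  \<open>k!\<^sup>2 / ((1/2)\<^bsub>2k+2\<^esub> (2k+1))\<close>. Put \<open>u = n + 1/2\<close>, \<open>s = 2n + 2k + 1\<close> and consider

    \<open>G(n,k) = (-1)\<^sup>n k!\<^sup>2 / (u)\<^bsub>2k+1\<^esub> \<cdot> 4/s\<close>   and
    \<open>F(n,k) = (-1)\<^sup>n k!\<^sup>2 / (u)\<^bsub>2k+2\<^esub> \<cdot> (6k+5+2n)/s\<close>.

  These form a Wilf-Zeilberger pair, \<open>G(n,k) - G(n,k+1) = F(n,k) - F(n+1,k)\<close>. Summing over all
  \<open>n\<close> and \<open>k\<close> moves the slowly converging series \<open>\<Sum> G(n,0) = 8 \<Sum> (-1)\<^sup>n/(2n+1)\<^sup>2\<close> to the rapidly
  converging \<open>\<Sum> F(0,k)\<close>, which is the series of the theorem without harmonic numbers.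

  The harmonic numbers come from perturbing this pair in a parameter and keeping the leading
  correction: \<open>G\<close> acquires a factor \<open>A(n,k)\<close>, and in \<open>F\<close> the quotient \<open>(6k+5+2n)/s\<close> is replaced by a
  function \<open>B(n,k)\<close>. Three perturbations are used.

    \<^item> Changing \<open>G\<close> into the term \<open>(-1)\<^sup>n (a+2n+2k) (b)\<^bsub>n+k\<^esub> (c)\<^bsub>n+k\<^esub> (d)\<^bsub>n\<^esub> (1+a-b-d)\<^bsub>k\<^esub> (1+a-c-d)\<^bsub>k\<^esub> /
      ((1+a-b)\<^bsub>n+k\<^esub> (1+a-c)\<^bsub>n+k\<^esub> (1+a-d)\<^bsub>n+2k\<^esub>)\<close>, which is \<open>G/8\<close> at \<open>a = 1\<close>, \<open>b = c = d = 1/2\<close>, along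
      the line \<open>a = 1 - 2t\<close>, \<open>b = c = (1 - t)/2\<close>, \<open>d = 1/2 - 2t\<close>: this produces \<open>4 H\<^bsub>2k-1\<^esub> - H\<^bsub>k-1\<^esub>\<close>.
    \<^item> Shifting \<open>n\<close> to \<open>n - t\<close> (apart from the sign \<open>(-1)\<^sup>n\<close>): this produces \<open>2 H\<^bsub>4k-1\<^esub> - H\<^bsub>2k-1\<^esub>\<close>.
    \<^item> Changing \<open>k!\<^sup>2\<close> into the product of the \<open>j\<^sup>2 - x\<^sup>2\<close>, \<open>1 \<le> j \<le> k\<close>, and \<open>1/s\<close> into
      \<open>s/(s\<^sup>2 - 4x\<^sup>2)\<close>, with leading correction of order \<open>x\<^sup>2\<close>: this produces the second-order numbers.

  At \<open>k = 0\<close> the three factors are \<open>4/(2n+1)\<close>, \<open>4/(2n+1)\<close> and \<open>4/(2n+1)\<^sup>2\<close>, so the slow sides are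
  \<open>32 \<beta>(3)\<close> twice and \<open>32 \<beta>(4)\<close>. Finally \<open>\<beta>(3) = \<pi>\<^sup>3/32\<close> by the reflection formula
  of the Gamma function. The lemma \<open>weighted_acceleration\<close> carries the analytic part for arbitrary
  \<open>A\<close> and \<open>B\<close>; what then remains for each perturbation is a rational function identity.
\<close>

section \<open>The cubic beta value\<close>

lemma Gamma_reflection_real:
  fixes x :: real
  shows "Gamma x * Gamma (1 - x) = pi / sin (pi * x)"
proof -
  have "complex_of_real (Gamma x * Gamma (1 - x)) = of_real (pi / sin (pi * x))"
    using Gamma_reflection_complex[of "of_real x"]
    by (simp add: Gamma_complex_of_real [symmetric] sin_of_real [symmetric])
  thus ?thesis by (simp only: of_real_eq_iff)
qed

lemma has_field_derivative_unique_on_unit_interval: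
  fixes f g f' g' :: "real \<Rightarrow> real"
  assumes "\<And>x. x \<in> {0<..<1} \<Longrightarrow> f x = g x"
    and "\<And>x. x \<in> {0<..<1} \<Longrightarrow> (f has_field_derivative f' x) (at x)"
    and "\<And>x. x \<in> {0<..<1} \<Longrightarrow> (g has_field_derivative g' x) (at x)"
    and "x \<in> {0<..<1}"
  shows "f' x = g' x"
proof -
  have "(g has_field_derivative f' x) (at x)"
    using has_field_derivative_transform_within_open[OF assms(2)[OF assms(4)], of "{0<..<1}" g] assms
    by auto
  thus ?thesis using assms(3)[OF assms(4)] by (rule DERIV_unique)
qed

text \<open>
  Taking logarithms in the reflection formula of the Gamma function gives
  \<open>ln \<Gamma>(x) + ln \<Gamma>(1 - x) = ln \<pi> - ln (sin (\<pi>x))\<close>; this is its third derivative.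
\<close>

lemma Polygamma_2_reflection:
  fixes x :: real
  assumes x: "x \<in> {0<..<1}"
  shows "Polygamma 2 x - Polygamma 2 (1 - x) = - (2 * pi ^ 3 * cos (pi * x) / sin (pi * x) ^ 3)"
proof -
  have spos: "sin (pi * y) > 0" if "y \<in> {0<..<1}" for y
    using that by (intro sin_gt_zero) auto
  have ni: "y \<notin> \<int>\<^sub>\<le>\<^sub>0" if "y > 0" for y :: real
    using that by (auto elim!: nonpos_Ints_cases)
  have 0: "ln_Gamma y + ln_Gamma (1 - y) = ln pi - ln (sin (pi * y))" if y: "y \<in> {0<..<1}" for y
  proof -
    have "Gamma y > 0" "Gamma (1 - y) > 0" using y by (auto intro: Gamma_real_pos)
    hence "ln_Gamma y + ln_Gamma (1 - y) = ln (Gamma y * Gamma (1 - y))"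
      using y by (simp add: ln_Gamma_real_pos ln_mult_pos)
    also have "\<dots> = ln pi - ln (sin (pi * y))"
      using spos[OF y] by (simp add: Gamma_reflection_real ln_div)
    finally show ?thesis .
  qed
  have 1: "Digamma y - Digamma (1 - y) = - (pi * cos (pi * y) / sin (pi * y))"
    if "y \<in> {0<..<1}" for y
    by (rule has_field_derivative_unique_on_unit_interval[OF 0 _ _ that])
      (use spos in \<open>auto intro!: derivative_eq_intros\<close>)
  have 2: "Polygamma 1 y + Polygamma 1 (1 - y) = pi ^ 2 / sin (pi * y) ^ 2"
    if "y \<in> {0<..<1}" for y
  proof (rule has_field_derivative_unique_on_unit_interval[OF 1 _ _ that])
    fix z :: real assume z: "z \<in> {0<..<1}"
    show "((\<lambda>y. Digamma y - Digamma (1 - y)) has_field_derivative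
            Polygamma 1 z + Polygamma 1 (1 - z)) (at z)"
      using z by (auto intro!: derivative_eq_intros ni)
    have eq: "sin (pi * z) ^ 2 + cos (pi * z) ^ 2 = 1" by simp
    show "((\<lambda>y. - (pi * cos (pi * y) / sin (pi * y))) has_field_derivative
            pi ^ 2 / sin (pi * z) ^ 2) (at z)"
      using spos[OF z]
      by (auto intro!: derivative_eq_intros simp: divide_simps) (insert eq, algebra)
  qed
  show ?thesis
  proof (rule has_field_derivative_unique_on_unit_interval[OF 2 _ _ x])
    fix z :: real assume z: "z \<in> {0<..<1}"
    show "((\<lambda>y. Polygamma 1 y + Polygamma 1 (1 - y)) has_field_derivative
            Polygamma 2 z - Polygamma 2 (1 - z)) (at z)"
      using z by (auto intro!: derivative_eq_intros ni simp: numeral_2_eq_2)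
    show "((\<lambda>y. pi ^ 2 / sin (pi * y) ^ 2) has_field_derivative
            - (2 * pi ^ 3 * cos (pi * z) / sin (pi * z) ^ 3)) (at z)"
      using spos[OF z]
      by (auto intro!: derivative_eq_intros simp: divide_simps power2_eq_square power3_eq_cube)
  qed
qed

lemma summable_inverse_odd_square: "summable (\<lambda>n. 1 / (2 * real n + 1) ^ 2)"
proof (rule summable_comparison_test')
  show "summable (\<lambda>n. 1 / real (Suc n) ^ 2)"
    using inverse_squares_sums by (simp add: sums_iff add.commute)
  show "norm (1 / (2 * real n + 1) ^ 2) \<le> 1 / real (Suc n) ^ 2" if "n \<ge> 0" for n
    by (auto intro!: divide_left_mono power_mono)
qed

lemma dirichlet_beta_sums:
  assumes "s \<ge> 2"
  shows "(\<lambda>n. (-1) ^ n / (2 * real n + 1) ^ s) sums dirichlet_beta s"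
proof -
  have "summable (\<lambda>n. (-1) ^ n / (2 * real n + 1) ^ s)"
  proof (rule summable_comparison_test'[OF summable_inverse_odd_square])
    fix n :: nat assume "n \<ge> 0"
    show "norm ((-1) ^ n / (2 * real n + 1) ^ s) \<le> 1 / (2 * real n + 1) ^ 2"
      using assms by (auto simp: power_abs intro!: divide_left_mono power_increasing)
  qed
  thus ?thesis by (simp add: dirichlet_beta_def summable_sums add.commute)
qed

text \<open>
  Pairing consecutive terms gives the differences of \<open>1/(4n+1)\<^sup>3\<close> and \<open>1/(4n+3)\<^sup>3\<close>, so the sum is a
  difference of values of the second polygamma function at the reflected points \<open>1/4\<close> and \<open>3/4\<close>.
\<close>

lemma dirichlet_beta_3: "dirichlet_beta 3 = pi ^ 3 / 32"
proof -
  have "(\<lambda>n. inverse ((1/4 + real n) ^ 3) - inverse ((3/4 + real n) ^ 3)) sums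
          (- (Polygamma 2 (1/4) / 2) - - (Polygamma 2 (3/4) / 2))"
    using sums_diff[OF Polygamma_LIMSEQ[of "1/4 :: real" 2] Polygamma_LIMSEQ[of "3/4 :: real" 2]]
    by (simp add: numeral_3_eq_3 [symmetric])
  also have "- (Polygamma 2 (1/4) / 2) - - (Polygamma 2 (3/4) / 2) = (2 * pi ^ 3 :: real)"
    using Polygamma_2_reflection[of "1/4"]
    by (simp add: sin_45 cos_45 power3_eq_cube field_simps)
  finally have "(\<lambda>n. (inverse ((1/4 + real n) ^ 3) - inverse ((3/4 + real n) ^ 3)) / 64) sums
      (2 * pi ^ 3 / 64)"
    by (rule sums_divide)
  moreover have "(\<lambda>n. \<Sum>i=n*2..<n*2+2. (-1) ^ i / (2 * real i + 1) ^ 3) sums dirichlet_beta 3"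
    by (rule sums_group[OF dirichlet_beta_sums]) auto
  moreover have "(\<Sum>i=n*2..<n*2+2. (-1) ^ i / (2 * real i + 1) ^ 3) =
      (inverse ((1/4 + real n) ^ 3) - inverse ((3/4 + real n) ^ 3)) / 64" for n
  proof -
    have "1/4 + real n = (2 * real (n * 2) + 1) / 4" "3/4 + real n = (2 * real (Suc (n * 2)) + 1) / 4"
      by simp_all
    thus ?thesis by (simp only:) (simp add: power_divide field_simps)
  qed
  ultimately have "(2 * pi ^ 3 / 64 :: real) = dirichlet_beta 3" by (simp only: sums_unique2)
  thus ?thesis by simp
qed

section \<open>Summation by Wilf-Zeilberger pairs\<close>

text \<open>
  Let \<open>S(k)\<close> be the sum of \<open>G(n,k)\<close> over \<open>n\<close>. Summing the relation over \<open>n\<close> telescopes on the right and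
  gives \<open>S(k) - S(k+1) = F(0,k)\<close>, which telescopes in turn because the domination of \<open>G\<close> forces
  \<open>S(k)\<close> to vanish in the limit.
\<close>

lemma WZ_pair_sums:
  fixes F G :: "nat \<Rightarrow> nat \<Rightarrow> real"
  assumes WZ: "\<And>n k. G n k - G n (Suc k) = F n k - F (Suc n) k"
    and F: "\<And>k. (\<lambda>n. F n k) \<longlonglongrightarrow> 0"
    and G: "\<And>n k. \<bar>G n k\<bar> \<le> c k * b n" "summable b" "c \<longlonglongrightarrow> 0"
    and base: "(\<lambda>n. G n 0) sums s"
  shows "(\<lambda>k. F 0 k) sums s"
proof -
  define S where "S k = (\<Sum>n. G n k)" for k
  have bsum: "summable (\<lambda>n. c k * b n)" for k
    by (rule summable_mult[OF G(2)])
  have Gsum: "summable (\<lambda>n. G n k)" for k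
    by (rule summable_comparison_test'[OF bsum]) (use G(1) in auto)
  have step: "S k - S (Suc k) = F 0 k" for k
  proof -
    have "(\<lambda>n. G n k - G n (Suc k)) sums (S k - S (Suc k))"
      unfolding S_def by (intro sums_diff summable_sums Gsum)
    moreover have "(\<lambda>n. G n k - G n (Suc k)) sums (F 0 k - 0)"
      unfolding WZ by (rule telescope_sums'[OF F])
    ultimately show ?thesis by (auto dest: sums_unique2)
  qed
  have "S \<longlonglongrightarrow> 0"
  proof (rule Lim_null_comparison)
    have "norm (S k) \<le> c k * suminf b" for k
    proof -
      have "norm (S k) \<le> (\<Sum>n. c k * b n)"
        unfolding S_def by (rule norm_suminf_le[OF _ bsum]) (use G(1) in auto)
      thus ?thesis using suminf_mult[OF G(2)] by simp
    qed
    thus "\<forall>\<^sub>F k in sequentially. norm (S k) \<le> c k * suminf b" by simp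
    show "(\<lambda>k. c k * suminf b) \<longlonglongrightarrow> 0"
      using tendsto_mult_left_zero[OF G(3)] .
  qed
  hence "(\<lambda>k. S k - S (Suc k)) sums (S 0 - 0)" by (rule telescope_sums')
  thus ?thesis using base by (simp add: step) (simp add: S_def sums_iff)
qed

lemma pochhammer_ge_fact:
  fixes x :: real
  assumes "x > 0"
  shows "pochhammer x (Suc m) \<ge> x * fact m"
proof -
  have "pochhammer (x + 1) m \<ge> pochhammer 1 m"
    unfolding pochhammer_prod using assms by (intro prod_mono) auto
  thus ?thesis using assms by (simp add: pochhammer_rec pochhammer_fact)
qed

text \<open>
  The hypothesis on \<open>A\<close> and \<open>B\<close> is the Wilf-Zeilberger relation between the weighted kernels, divided
  by the common factor \<open>(-1)\<^sup>n k!\<^sup>2 / (u)\<^bsub>2k+3\<^esub>\<close>; it holds for \<open>A = 1\<close> and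
  \<open>B = (6k+5+2n)/s\<close>. The linear growth allowed for \<open>A\<close> suits harmonic numbers
  and is harmless, since the kernel decays like \<open>4\<^sup>-\<^sup>k\<close> up to a power of \<open>k\<close>.
\<close>

lemma weighted_acceleration:
  fixes A B :: "nat \<Rightarrow> nat \<Rightarrow> real"
  assumes rel: "\<And>n k u s. u = real n + 1/2 \<Longrightarrow> s = 2 * u + 2 * real k \<Longrightarrow>
      4 * (u + 2 * real k + 1) * (u + 2 * real k + 2) / s * A n k
        - 4 * (real k + 1) ^ 2 / (s + 2) * A n (Suc k)
      = (u + 2 * real k + 2) * B n k + u * B (Suc n) k"
    and A: "\<And>n k. \<bar>A n k\<bar> \<le> C * (real k + 1)"
    and B: "\<And>n k. \<bar>B n k\<bar> \<le> E k"
    and base: "(\<lambda>n. 8 * (-1) ^ n / (2 * real n + 1) ^ 2 * A n 0) sums \<sigma>"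
  shows "(\<lambda>k. fact k ^ 2 / pochhammer (1/2) (2 * k + 2) * B 0 k) sums \<sigma>"
proof -
  define u where "u n = real n + 1/2" for n
  define G where "G n k = (-1) ^ n * fact k ^ 2 / pochhammer (u n) (2 * k + 1)
      * (4 / (2 * u n + 2 * real k)) * A n k" for n k
  define F where "F n k = (-1) ^ n * fact k ^ 2 / pochhammer (u n) (2 * k + 2) * B n k" for n k
  have u: "u n > 0" "u n \<ge> 1/2" for n by (auto simp: u_def)
  have "(\<lambda>k. F 0 k) sums \<sigma>"
  proof (rule WZ_pair_sums)
    fix n k
    \<comment> \<open>The four Pochhammer symbols of the relation all divide this one.\<close>
    define P where "P = pochhammer (u n) (2 * k + 3)"
    define x where "x = real k"
    define v where "v = u n"
    have pos: "v > 0" "x \<ge> 0" using u by (auto simp: v_def x_def)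
    have P2: "P = pochhammer (u n) (2 * k + 2) * (v + 2 * x + 2)"
      using pochhammer_Suc[of "u n" "2 * k + 2"]
      by (simp add: P_def v_def x_def eval_nat_numeral add_ac)
    have "pochhammer (u n) (2 * k + 2) = pochhammer (u n) (2 * k + 1) * (v + 2 * x + 1)"
      using pochhammer_Suc[of "u n" "2 * k + 1"]
      by (simp add: v_def x_def eval_nat_numeral add_ac)
    with P2 have P1: "P = pochhammer (u n) (2 * k + 1) * ((v + 2 * x + 1) * (v + 2 * x + 2))"
      by simp
    have "u (Suc n) = v + 1" by (simp add: u_def v_def)
    hence P3: "P = v * pochhammer (u (Suc n)) (2 * k + 2)"
      using pochhammer_rec[of "u n" "2 * k + 2"] by (simp add: P_def v_def eval_nat_numeral)
    have nz: "v + 2 * x + 2 > 0" "v + 2 * x + 1 > 0"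
      using pos by linarith+
    define K where "K = (-1) ^ n * fact k ^ 2 / P"
    have G1: "G n k = K * (4 * (v + 2 * x + 1) * (v + 2 * x + 2) / (2 * v + 2 * x) * A n k)"
    proof -
      have cancel: "c / p * (4 / s) * y = c / (p * (a * b)) * (4 * a * b / s * y)"
        if "a > 0" "b > 0" for a b c p s y :: real
        using that by simp
      show ?thesis
        unfolding G_def K_def P1 v_def x_def by (rule cancel) (use nz in \<open>auto simp: v_def x_def\<close>)
    qed
    have G2: "G n (Suc k) = K * (4 * (x + 1) ^ 2 / (2 * v + 2 * x + 2) * A n (Suc k))"
    proof -
      have "2 * Suc k + 1 = 2 * k + 3" "2 * u n + 2 * real (Suc k) = 2 * v + 2 * x + 2"
        and "fact (Suc k) ^ 2 = ((x + 1) ^ 2 * fact k ^ 2 :: real)"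
        by (simp_all add: v_def x_def power_mult_distrib add_ac)
      moreover have "z * (d * c) / p * (4 / s) * a = z * c / p * (4 * d / s * a)" for z c d p s a :: real
        by (simp add: field_simps)
      ultimately show ?thesis unfolding G_def K_def P_def by (simp only:)
    qed
    have F1: "F n k = K * ((v + 2 * x + 2) * B n k)"
      using nz unfolding F_def K_def P2 by (simp add: v_def x_def)
    have F2: "F (Suc n) k = - (K * (v * B (Suc n) k))"
    proof -
      have cancel: "- c / p * y = - (c / (v * p) * (v * y))" for c p y
        using pos(1) by simp
      have "(-1) ^ Suc n * fact k ^ 2 = - ((-1) ^ n * fact k ^ 2 :: real)" by simp
      thus ?thesis unfolding F_def K_def P3 by (simp only: cancel)
    qed
    show "G n k - G n (Suc k) = F n k - F (Suc n) k"
    proof -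
      have "a - b = c + d \<Longrightarrow> K * a - K * b = K * c - - (K * d)" for a b c d
        by (simp flip: right_diff_distrib distrib_left)
      thus ?thesis
        unfolding G1 G2 F1 F2
        using rel[of v n "2 * v + 2 * x" k] by (simp only: u_def v_def x_def)
    qed
  next
    fix k
    show "(\<lambda>n. F n k) \<longlonglongrightarrow> 0"
    proof (rule Lim_null_comparison)
      have "norm (F n k) \<le> fact k ^ 2 * E k / real (Suc n) * 2" for n
      proof -
        have "u n * 1 \<le> u n * fact (2 * k + 1)"
          using u[of n] by (intro mult_left_mono fact_ge_1) auto
        also have "\<dots> \<le> pochhammer (u n) (2 * k + 2)"
          using pochhammer_ge_fact[of "u n" "2 * k + 1"] u by simp
        finally have p: "real (Suc n) / 2 \<le> pochhammer (u n) (2 * k + 2)"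
          by (simp add: u_def)
        have "norm (F n k) = fact k ^ 2 / pochhammer (u n) (2 * k + 2) * \<bar>B n k\<bar>"
          using p by (simp add: F_def abs_mult power_abs)
        also have "\<dots> \<le> fact k ^ 2 / (real (Suc n) / 2) * E k"
          using p B[of n k] by (intro mult_mono divide_left_mono mult_pos_pos) auto
        finally show ?thesis by (simp add: field_simps)
      qed
      thus "\<forall>\<^sub>F n in sequentially. norm (F n k) \<le> fact k ^ 2 * E k / real (Suc n) * 2"
        by simp
      show "(\<lambda>n. fact k ^ 2 * E k / real (Suc n) * 2) \<longlonglongrightarrow> 0"
        by (intro tendsto_mult_left_zero LIMSEQ_Suc lim_const_over_n)
    qed
  next
    fix n k
    \<comment> \<open>The denominator is at least \<open>u (2k)!\<close>, so the kernel is controlled by the central binomial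
      coefficient.\<close>
    have "4 ^ k / (2 * (real k + 1)) \<le> real ((2 * k) choose k)"
    proof (cases "k = 0")
      case False
      have "4 ^ k / (2 * (real k + 1)) \<le> 4 ^ k / (2 * real k)"
        using False by (intro divide_left_mono) auto
      thus ?thesis using central_binomial_lower_bound[of k] False by simp
    qed auto
    also have "\<dots> = fact (2 * k) / (fact k * fact k)"
      by (subst binomial_fact) auto
    finally have "fact k ^ 2 * (4 ^ k / (2 * (real k + 1))) \<le> fact (2 * k)"
      by (simp add: field_simps power2_eq_square)
    hence "u n * fact k ^ 2 * (4 ^ k / (2 * (real k + 1))) \<le> u n * fact (2 * k)"
      using u[of n] by (simp add: mult.assoc del: times_divide_eq_right)
    also have "\<dots> \<le> pochhammer (u n) (2 * k + 1)"
      using pochhammer_ge_fact[of "u n" "2 * k"] u by simp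
    finally have p: "u n * fact k ^ 2 * (4 ^ k / (2 * (real k + 1))) \<le> pochhammer (u n) (2 * k + 1)" .
    have ppos: "pochhammer (u n) (2 * k + 1) > 0" using u by (intro pochhammer_pos)
    have "\<bar>G n k\<bar> = fact k ^ 2 / pochhammer (u n) (2 * k + 1) * (4 / (2 * u n + 2 * real k)) * \<bar>A n k\<bar>"
      using ppos u[of n] by (simp add: G_def abs_mult power_abs)
    also have "\<dots> \<le> fact k ^ 2 / (u n * fact k ^ 2 * (4 ^ k / (2 * (real k + 1)))) * (4 / (2 * u n))
        * (C * (real k + 1))"
      using p ppos u[of n] A[of n k]
      by (intro mult_mono divide_left_mono mult_pos_pos) auto
    also have "\<dots> = (16 * C * ((real k + 1) ^ 2 / 4 ^ k)) * (1 / (2 * real n + 1) ^ 2)"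
    proof -
      have "2 * real n + 1 = 2 * u n" by (simp add: u_def)
      thus ?thesis using u[of n] by (simp only:) (simp add: field_simps power2_eq_square)
    qed
    finally show "\<bar>G n k\<bar> \<le> (16 * C * ((real k + 1) ^ 2 / 4 ^ k)) * (1 / (2 * real n + 1) ^ 2)" .
  next
    show "(\<lambda>k. 16 * C * ((real k + 1) ^ 2 / 4 ^ k)) \<longlonglongrightarrow> 0"
      by (intro tendsto_mult_right_zero) real_asymp
  next
    have "G n 0 = 8 * (-1) ^ n / (2 * real n + 1) ^ 2 * A n 0" for n
    proof -
      have "2 * real n + 1 = 2 * u n" by (simp add: u_def)
      thus ?thesis using u[of n] by (simp only:) (simp add: G_def field_simps power2_eq_square)
    qed
    thus "(\<lambda>n. G n 0) sums \<sigma>" using base by simp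
  qed (rule summable_inverse_odd_square)
  thus ?thesis by (simp add: F_def u_def)
qed

section \<open>The three weights\<close>

text \<open>
  The logarithmic derivative of the Pochhammer symbol \<open>(x)\<^bsub>m\<^esub>\<close> with respect to \<open>x\<close>; it is what
  differentiating the kernel leaves behind.
\<close>

definition pochhammer_harm :: "real \<Rightarrow> nat \<Rightarrow> real" where
  "pochhammer_harm x m = (\<Sum>j<m. 1 / (x + real j))"

lemma pochhammer_harm_0 [simp]: "pochhammer_harm x 0 = 0"
  by (simp add: pochhammer_harm_def)

lemma pochhammer_harm_Suc:
  "pochhammer_harm x (Suc m) = pochhammer_harm x m + 1 / (x + real m)"
  by (simp add: pochhammer_harm_def)

lemma pochhammer_harm_shift:
  "pochhammer_harm (x + 1) m = pochhammer_harm x m + 1 / (x + real m) - 1 / x"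
  by (induction m) (auto simp: pochhammer_harm_Suc add_ac)

lemma pochhammer_harm_bounds:
  assumes "x \<ge> 1/2"
  shows "0 \<le> pochhammer_harm x m" "pochhammer_harm x m \<le> 2 * real m"
proof -
  have "1 / (x + real j) \<le> 2" for j using assms by (simp add: field_simps)
  thus "0 \<le> pochhammer_harm x m" "pochhammer_harm x m \<le> 2 * real m"
    using assms unfolding pochhammer_harm_def
    by (auto intro!: sum_nonneg order.trans[OF sum_bounded_above[where K = 2]])
qed

lemma pochhammer_harm_half: "pochhammer_harm (1/2) (Suc m) = 2 * harm (2 * m + 1) - harm m"
proof (induction m)
  case (Suc m)
  have "2 * Suc m + 1 = Suc (Suc (2 * m + 1))" by simp
  hence "harm (2 * Suc m + 1) = harm (2 * m + 1) + 1 / (2 * real m + 2) + 1 / (2 * real m + 3)"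
    by (simp only: harm_Suc) (simp add: field_simps)
  thus ?case
  proof -
    have "1 / (real m + 1) = 2 * (1 / (2 * real m + 2))"
      and "1 / (1/2 + real (Suc m)) = 2 * (1 / (2 * real m + 3))"
      by (simp_all add: field_simps)
    moreover have "harm (Suc m) = harm m + 1 / (real m + 1)"
      by (simp add: harm_Suc inverse_eq_divide add_ac)
    ultimately show ?thesis
      using Suc \<open>harm (2 * Suc m + 1) = _\<close> pochhammer_harm_Suc[of "1/2" "Suc m"] by linarith
  qed
qed (simp add: pochhammer_harm_Suc harm_Suc harm_def)

lemma gen_harm_Suc: "gen_harm m (Suc n) = gen_harm m n + 1 / real (Suc n) ^ m"
  by (simp add: gen_harm_def)

lemma gen_harm_bounds: "0 \<le> gen_harm m n" "gen_harm m n \<le> real n"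
proof -
  have "1 / real j ^ m \<le> 1" if "j \<in> {1..n}" for j
    using that by (auto simp: field_simps)
  hence "gen_harm m n \<le> of_nat (card {1..n}) * 1"
    unfolding gen_harm_def by (intro sum_bounded_above)
  thus "gen_harm m n \<le> real n" by simp
qed (auto simp: gen_harm_def intro!: sum_nonneg)

text \<open>
  In each of the next three lemmas \<open>A\<close> is the leading relative correction of the kernel under one
  of the perturbations described at the beginning; in the first case the constant \<open>-6\<close> is
  dropped, which amounts to adding a multiple of the unperturbed pair. In the relation to be checked, the
  coefficients of the harmonic sums cancel because the unperturbed pair satisfies it, and a rational
  identity in \<open>n\<close> and \<open>k\<close> is left.

  The well-poised direction makes the sums over \<open>n\<close> telescope: the sums from the numerator and the
  denominator parameters cancel except for a piece of length \<open>k\<close>. Hence \<open>A\<close> is bounded in \<open>n\<close>, and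
  it reduces to \<open>4/(2n+1)\<close> at \<open>k = 0\<close>.
\<close>

lemma weight1_sums:
  "(\<lambda>k. fact k ^ 2 / pochhammer (1/2) (2 * k + 2) *
      ((6 * real k + 5) / (2 * real k + 1) * (gen_harm 1 k + 2 * pochhammer_harm (1/2) (Suc k))))
   sums (32 * dirichlet_beta 3)"
proof -
  define A where "A n k = 4 / (2 * (real n + 1/2) + 2 * real k)
      + 2 * pochhammer_harm (real n + 1/2) k + gen_harm 1 k" for n k
  define B where "B n k = (6 * real k + 4 + 2 * (real n + 1/2)) / (2 * (real n + 1/2) + 2 * real k)
      * (gen_harm 1 k + 2 * pochhammer_harm (real n + 1/2) (Suc k))" for n k
  have "(\<lambda>k. fact k ^ 2 / pochhammer (1/2) (2 * k + 2) * B 0 k) sums (32 * dirichlet_beta 3)"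
  proof (rule weighted_acceleration)
    fix n k :: nat and u s :: real
    assume u: "u = real n + 1/2" and s: "s = 2 * u + 2 * real k"
    define x where "x = real k"
    define H where "H = gen_harm 1 k"
    define Q where "Q = pochhammer_harm u k"
    have pos: "u > 0" "x \<ge> 0" by (auto simp: u x_def)
    have A1: "A n k = 4 / (2 * u + 2 * x) + 2 * Q + H"
      by (simp add: A_def u x_def Q_def H_def)
    have A2: "A n (Suc k) = 4 / (2 * u + 2 * x + 2) + 2 * (Q + 1 / (u + x)) + (H + 1 / (x + 1))"
      by (simp add: A_def u x_def Q_def H_def pochhammer_harm_Suc gen_harm_Suc add_ac)
    have B1: "B n k = (6 * x + 4 + 2 * u) / (2 * u + 2 * x) * (H + 2 * (Q + 1 / (u + x)))"
      by (simp add: B_def u x_def Q_def H_def pochhammer_harm_Suc)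
    have sh: "real (Suc n) + 1/2 = u + 1" by (simp add: u)
    have B2: "B (Suc n) k = (6 * x + 6 + 2 * u) / (2 * u + 2 * x + 2)
        * (H + 2 * (Q + 1 / (u + x) - 1 / u + 1 / (u + 1 + x)))"
      unfolding B_def sh pochhammer_harm_Suc pochhammer_harm_shift
      by (simp add: x_def Q_def H_def add_ac)
    show "4 * (u + 2 * real k + 1) * (u + 2 * real k + 2) / s * A n k
        - 4 * (real k + 1) ^ 2 / (s + 2) * A n (Suc k)
      = (u + 2 * real k + 2) * B n k + u * B (Suc n) k"
      unfolding A1 A2 B1 B2 s x_def [symmetric] using pos
      by (simp add: divide_simps add_pos_nonneg add_nonneg_pos) algebra
  next
    fix n k :: nat
    have "4 / (2 * (real n + 1/2) + 2 * real k) \<le> 4" by (simp add: field_simps)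
    moreover have "4 / (2 * (real n + 1/2) + 2 * real k) \<ge> 0" by simp
    ultimately show "\<bar>A n k\<bar> \<le> 5 * (real k + 1)"
      using pochhammer_harm_bounds[of "real n + 1/2" k] gen_harm_bounds[of 1 k]
      unfolding A_def by (simp add: abs_le_iff)
  next
    fix n k :: nat
    have "(6 * real k + 4 + 2 * (real n + 1/2)) / (2 * (real n + 1/2) + 2 * real k) \<le> 6 * real k + 5"
      by (simp add: field_simps)
    thus "\<bar>B n k\<bar> \<le> (6 * real k + 5) * (5 * real k + 4)"
      using pochhammer_harm_bounds[of "real n + 1/2" "Suc k"] gen_harm_bounds[of 1 k]
      unfolding B_def abs_mult by (intro mult_mono) auto
  next
    have "8 * (-1) ^ n / (2 * real n + 1) ^ 2 * A n 0 = 32 * ((-1) ^ n / (2 * real n + 1) ^ 3)" for n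
      by (simp add: A_def gen_harm_def power2_eq_square power3_eq_cube add_ac)
    thus "(\<lambda>n. 8 * (-1) ^ n / (2 * real n + 1) ^ 2 * A n 0) sums (32 * dirichlet_beta 3)"
      using sums_mult[OF dirichlet_beta_sums[of 3]] by simp
  qed
  thus ?thesis by (simp add: B_def add_ac)
qed

text \<open>
  Here \<open>A\<close> is the negative logarithmic derivative in \<open>n\<close> of \<open>1 / (s (u)\<^bsub>2k+1\<^esub>)\<close>. The term
  \<open>8(k+1)/s\<^sup>2\<close> of \<open>B\<close> is the negative derivative of \<open>(6k+5+2n)/s\<close>.
\<close>

lemma weight2_sums:
  "(\<lambda>k. fact k ^ 2 / pochhammer (1/2) (2 * k + 2) *
      ((6 * real k + 5) / (2 * real k + 1) * pochhammer_harm (1/2) (2 * k + 2)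
        + 8 * (real k + 1) / (2 * real k + 1) ^ 2))
   sums (32 * dirichlet_beta 3)"
proof -
  define A where "A n k = 2 / (2 * (real n + 1/2) + 2 * real k)
      + pochhammer_harm (real n + 1/2) (2 * k + 1)" for n k
  define B where "B n k = (6 * real k + 4 + 2 * (real n + 1/2)) / (2 * (real n + 1/2) + 2 * real k)
      * pochhammer_harm (real n + 1/2) (2 * k + 2)
      + 8 * (real k + 1) / (2 * (real n + 1/2) + 2 * real k) ^ 2" for n k
  have "(\<lambda>k. fact k ^ 2 / pochhammer (1/2) (2 * k + 2) * B 0 k) sums (32 * dirichlet_beta 3)"
  proof (rule weighted_acceleration)
    fix n k :: nat and u s :: real
    assume u: "u = real n + 1/2" and s: "s = 2 * u + 2 * real k"
    define x where "x = real k"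
    define Q where "Q = pochhammer_harm u (2 * k + 1)"
    have pos: "u > 0" "x \<ge> 0" by (auto simp: u x_def)
    have indices: "2 * k + 2 = Suc (2 * k + 1)" "2 * Suc k + 1 = Suc (Suc (2 * k + 1))" by simp_all
    have A1: "A n k = 2 / (2 * u + 2 * x) + Q"
      by (simp add: A_def u x_def Q_def)
    have A2: "A n (Suc k) = 2 / (2 * u + 2 * x + 2) + (Q + 1 / (u + 2 * x + 1) + 1 / (u + 2 * x + 2))"
      unfolding A_def indices pochhammer_harm_Suc u [symmetric]
      by (simp add: x_def Q_def pochhammer_harm_Suc add_ac)
    have B1: "B n k = (6 * x + 4 + 2 * u) / (2 * u + 2 * x) * (Q + 1 / (u + 2 * x + 1))
        + 8 * (x + 1) / (2 * u + 2 * x) ^ 2"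
      unfolding B_def indices pochhammer_harm_Suc u [symmetric]
      by (simp add: x_def Q_def pochhammer_harm_Suc add_ac)
    have sh: "real (Suc n) + 1/2 = u + 1" by (simp add: u)
    have B2: "B (Suc n) k = (6 * x + 6 + 2 * u) / (2 * u + 2 * x + 2)
        * (Q + 1 / (u + 2 * x + 1) + 1 / (u + 2 * x + 2) - 1 / u)
        + 8 * (x + 1) / (2 * u + 2 * x + 2) ^ 2"
      unfolding B_def sh indices pochhammer_harm_shift pochhammer_harm_Suc
      by (simp add: x_def Q_def pochhammer_harm_Suc add_ac)
    show "4 * (u + 2 * real k + 1) * (u + 2 * real k + 2) / s * A n k
        - 4 * (real k + 1) ^ 2 / (s + 2) * A n (Suc k)
      = (u + 2 * real k + 2) * B n k + u * B (Suc n) k"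
      unfolding A1 A2 B1 B2 s x_def [symmetric] using pos
      by (simp add: divide_simps add_pos_nonneg add_nonneg_pos) algebra
  next
    fix n k :: nat
    have "2 / (2 * (real n + 1/2) + 2 * real k) \<le> 2" by (simp add: field_simps)
    moreover have "2 / (2 * (real n + 1/2) + 2 * real k) \<ge> 0" by simp
    ultimately show "\<bar>A n k\<bar> \<le> 4 * (real k + 1)"
      using pochhammer_harm_bounds[of "real n + 1/2" "2 * k + 1"]
      unfolding A_def by (simp add: abs_le_iff)
  next
    fix n k :: nat
    define H where "H = pochhammer_harm (real n + 1/2) (2 * k + 2)"
    have H: "0 \<le> H" "H \<le> 4 * real k + 4"
      using pochhammer_harm_bounds[of "real n + 1/2" "2 * k + 2"] by (auto simp: H_def)
    have "(6 * real k + 4 + 2 * (real n + 1/2)) / (2 * (real n + 1/2) + 2 * real k) \<le> 6 * real k + 5"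
      by (simp add: field_simps)
    hence 1: "\<bar>(6 * real k + 4 + 2 * (real n + 1/2)) / (2 * (real n + 1/2) + 2 * real k) * H\<bar>
        \<le> (6 * real k + 5) * (4 * real k + 4)"
      using H unfolding abs_mult by (intro mult_mono) auto
    have "1 \<le> (2 * (real n + 1/2) + 2 * real k) ^ 2" by (intro one_le_power) auto
    hence "\<bar>8 * (real k + 1) / (2 * (real n + 1/2) + 2 * real k) ^ 2\<bar> \<le> 8 * (real k + 1) / 1"
      unfolding abs_divide by (intro frac_le) auto
    with 1 show "\<bar>B n k\<bar> \<le> (6 * real k + 5) * (4 * real k + 4) + 8 * (real k + 1) / 1"
      unfolding B_def H_def [symmetric] by linarith
  next
    have "8 * (-1) ^ n / (2 * real n + 1) ^ 2 * A n 0 = 32 * ((-1) ^ n / (2 * real n + 1) ^ 3)" for n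
    proof -
      have "1 / (real n + 1/2) = 2 / (2 * real n + 1)" by (simp add: field_simps)
      hence "A n 0 = 4 / (2 * real n + 1)"
        by (simp add: A_def pochhammer_harm_Suc add_ac)
      thus ?thesis by (simp add: power2_eq_square power3_eq_cube)
    qed
    thus "(\<lambda>n. 8 * (-1) ^ n / (2 * real n + 1) ^ 2 * A n 0) sums (32 * dirichlet_beta 3)"
      using sums_mult[OF dirichlet_beta_sums[of 3]] by simp
  qed
  thus ?thesis by (simp add: B_def add_ac)
qed

text \<open>
  Under the third perturbation \<open>(6k+5+2n)/s\<close> becomes
  \<open>((6k+5+2n) s + 4x\<^sup>2) / (s\<^sup>2 - 4x\<^sup>2)\<close>, whose coefficient of \<open>x\<^sup>2\<close> is
  \<open>4 (8k+6+4n) / s\<^sup>3\<close>; the product of the \<open>j\<^sup>2 - x\<^sup>2\<close>, relative to \<open>k!\<^sup>2\<close>, contributes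
  \<open>-H\<^bsub>k\<^esub>\<^bsup>(2)\<^esup>\<close> as coefficient of \<open>x\<^sup>2\<close>.
\<close>

lemma weight3_sums:
  "(\<lambda>k. fact k ^ 2 / pochhammer (1/2) (2 * k + 2) *
      (8 * (4 * real k + 3) / (2 * real k + 1) ^ 3
        - (6 * real k + 5) / (2 * real k + 1) * gen_harm 2 k))
   sums (32 * dirichlet_beta 4)"
proof -
  define A where "A n k = 4 / (2 * (real n + 1/2) + 2 * real k) ^ 2 - gen_harm 2 k" for n k
  define B where "B n k = 4 * (8 * real k + 4 + 4 * (real n + 1/2))
      / (2 * (real n + 1/2) + 2 * real k) ^ 3
      - (6 * real k + 4 + 2 * (real n + 1/2)) / (2 * (real n + 1/2) + 2 * real k) * gen_harm 2 k"
    for n k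
  have "(\<lambda>k. fact k ^ 2 / pochhammer (1/2) (2 * k + 2) * B 0 k) sums (32 * dirichlet_beta 4)"
  proof (rule weighted_acceleration)
    fix n k :: nat and u s :: real
    assume u: "u = real n + 1/2" and s: "s = 2 * u + 2 * real k"
    define x where "x = real k"
    define H where "H = gen_harm 2 k"
    have pos: "u > 0" "x \<ge> 0" by (auto simp: u x_def)
    have A1: "A n k = 4 / (2 * u + 2 * x) ^ 2 - H"
      by (simp add: A_def u x_def H_def)
    have A2: "A n (Suc k) = 4 / (2 * u + 2 * x + 2) ^ 2 - (H + 1 / (x + 1) ^ 2)"
      by (simp add: A_def u x_def H_def gen_harm_Suc add_ac)
    have B1: "B n k = 4 * (8 * x + 4 + 4 * u) / (2 * u + 2 * x) ^ 3
        - (6 * x + 4 + 2 * u) / (2 * u + 2 * x) * H"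
      by (simp add: B_def u x_def H_def)
    have sh: "real (Suc n) + 1/2 = u + 1" by (simp add: u)
    have B2: "B (Suc n) k = 4 * (8 * x + 8 + 4 * u) / (2 * u + 2 * x + 2) ^ 3
        - (6 * x + 6 + 2 * u) / (2 * u + 2 * x + 2) * H"
      unfolding B_def sh by (simp add: x_def H_def add_ac)
    show "4 * (u + 2 * real k + 1) * (u + 2 * real k + 2) / s * A n k
        - 4 * (real k + 1) ^ 2 / (s + 2) * A n (Suc k)
      = (u + 2 * real k + 2) * B n k + u * B (Suc n) k"
      unfolding A1 A2 B1 B2 s x_def [symmetric] using pos
      by (simp add: divide_simps add_pos_nonneg add_nonneg_pos) algebra
  next
    fix n k :: nat
    define q where "q = 4 / (2 * (real n + 1/2) + 2 * real k) ^ 2"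
    have "1 \<le> (2 * (real n + 1/2) + 2 * real k) ^ 2" by (intro one_le_power) auto
    hence "q \<le> 4 / 1" unfolding q_def by (intro frac_le) auto
    moreover have "q \<ge> 0" by (simp add: q_def)
    ultimately show "\<bar>A n k\<bar> \<le> 4 * (real k + 1)"
      using gen_harm_bounds[of 2 k] unfolding A_def q_def [symmetric] by (simp add: abs_le_iff)
  next
    fix n k :: nat
    define s where "s = 2 * (real n + 1/2) + 2 * real k"
    have s: "s \<ge> 1" by (simp add: s_def)
    have "(6 * real k + 4 + 2 * (real n + 1/2)) / s \<le> 6 * real k + 5"
      by (simp add: s_def field_simps)
    hence 1: "\<bar>(6 * real k + 4 + 2 * (real n + 1/2)) / s * gen_harm 2 k\<bar> \<le> (6 * real k + 5) * real k"
      using gen_harm_bounds[of 2 k] s unfolding abs_mult by (intro mult_mono) auto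
    have "4 * (8 * real k + 4 + 4 * (real n + 1/2)) / s ^ 3 \<le> 4 * (8 * real k + 4 + 4 * (real n + 1/2)) / s"
      using s self_le_power[of s 3] by (intro divide_left_mono) auto
    also have "\<dots> \<le> 4 * (8 * real k + 6)"
      by (simp add: s_def field_simps)
    finally have "4 * (8 * real k + 4 + 4 * (real n + 1/2)) / s ^ 3 \<le> 4 * (8 * real k + 6)" .
    moreover have "4 * (8 * real k + 4 + 4 * (real n + 1/2)) / s ^ 3 \<ge> 0" using s by simp
    ultimately show "\<bar>B n k\<bar> \<le> 4 * (8 * real k + 6) + (6 * real k + 5) * real k"
      using 1 unfolding B_def s_def [symmetric] by linarith
  next
    have "8 * (-1) ^ n / (2 * real n + 1) ^ 2 * A n 0 = 32 * ((-1) ^ n / (2 * real n + 1) ^ 4)" for n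
      by (simp add: A_def gen_harm_def power2_eq_square power4_eq_xxxx add_ac)
    thus "(\<lambda>n. 8 * (-1) ^ n / (2 * real n + 1) ^ 2 * A n 0) sums (32 * dirichlet_beta 4)"
      using sums_mult[OF dirichlet_beta_sums[of 4]] by simp
  qed
  thus ?thesis by (simp add: B_def add_ac)
qed

section \<open>The three series\<close>

lemma binomial_summand_eq_pochhammer:
  "16 ^ Suc k / ((2 * real (Suc k) - 1) * real (Suc k) ^ 2
      * real ((2 * Suc k) choose Suc k) * real ((4 * Suc k) choose (2 * Suc k)))
   = fact k ^ 2 / pochhammer (1/2) (2 * k + 2) / (2 * real k + 1)"
proof -
  define m where "m = Suc k"
  have c1: "real ((2 * m) choose m) = fact (2 * m) / (fact m * fact m)"
    by (subst binomial_fact) auto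
  have "4 * m = 2 * (2 * m)" by simp
  hence c2: "real ((4 * m) choose (2 * m)) = fact (2 * (2 * m)) / (fact (2 * m) * fact (2 * m))"
    by (simp only:) (subst binomial_fact, auto)
  have f: "fact (2 * (2 * m)) = (16 ^ m * pochhammer (1/2) (2 * m) * fact (2 * m) :: real)"
    by (subst fact_double) (simp add: power_mult)
  have p: "pochhammer (1/2 :: real) (2 * m) > 0" by (rule pochhammer_pos) simp
  have "16 ^ m / ((2 * real m - 1) * real m ^ 2 * real ((2 * m) choose m) * real ((4 * m) choose (2 * m)))
      = fact m ^ 2 / real m ^ 2 / pochhammer (1/2) (2 * m) / (2 * real m - 1)"
    unfolding c1 c2 f using p by (simp add: power2_eq_square)
  also have "fact m ^ 2 / real m ^ 2 = (fact k ^ 2 :: real)"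
    by (simp add: m_def power_mult_distrib)
  finally show ?thesis by (simp add: m_def)
qed

theorem theorem1p4:
  shows "((\<lambda>i. let k = Suc i in
            16 ^ k * (6 * real k - 1) * (4 * harm (2 * k - 1) - harm (k - 1))
            / ((2 * real k - 1) * real k ^ 2 * real ((2 * k) choose k) * real ((4 * k) choose (2 * k))))
         sums (pi ^ 3))
    \<and> ((\<lambda>i. let k = Suc i in
            16 ^ k * ((6 * real k - 1) * (2 * harm (4 * k - 1) - harm (2 * k - 1))
                      + 8 * real k / (2 * real k - 1))
            / ((2 * real k - 1) * real k ^ 2 * real ((2 * k) choose k) * real ((4 * k) choose (2 * k))))
         sums (pi ^ 3))
    \<and> ((\<lambda>i. let k = Suc i in
            16 ^ k * ((6 * real k - 1) * gen_harm 2 (k - 1)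
                      - 8 * (4 * real k - 1) / (2 * real k - 1) ^ 2)
            / ((2 * real k - 1) * real k ^ 2 * real ((2 * k) choose k) * real ((4 * k) choose (2 * k))))
         sums (- 32 * dirichlet_beta 4))"
proof (intro conjI)
  have shape: "16 ^ Suc i * W / ((2 * real (Suc i) - 1) * real (Suc i) ^ 2
        * real ((2 * Suc i) choose Suc i) * real ((4 * Suc i) choose (2 * Suc i)))
      = fact i ^ 2 / pochhammer (1/2) (2 * i + 2) * (W / (2 * real i + 1))" for i W
  proof -
    have "x * W / y = a / b * (W / c)" if "x / y = a / b / c" for x y a b c :: real
      using arg_cong[OF that, of "\<lambda>t. t * W"] by (simp add: mult_ac)
    thus ?thesis using binomial_summand_eq_pochhammer by blast
  qed
  have h1: "4 * harm (2 * Suc i - 1) - harm (Suc i - 1)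
      = gen_harm 1 i + 2 * pochhammer_harm (1/2) (Suc i)" for i
    by (simp only: gen_harm_1 pochhammer_harm_half) simp
  have h2: "2 * harm (4 * Suc i - 1) - harm (2 * Suc i - 1) = pochhammer_harm (1/2) (2 * i + 2)" for i
  proof -
    have "4 * Suc i - 1 = 2 * (2 * i + 1) + 1" "2 * Suc i - 1 = 2 * i + 1"
      and "2 * i + 2 = Suc (2 * i + 1)" by simp_all
    thus ?thesis by (simp only: pochhammer_harm_half)
  qed
  show "(\<lambda>i. let k = Suc i in
      16 ^ k * (6 * real k - 1) * (4 * harm (2 * k - 1) - harm (k - 1))
      / ((2 * real k - 1) * real k ^ 2 * real ((2 * k) choose k) * real ((4 * k) choose (2 * k))))
      sums (pi ^ 3)"
    using weight1_sums unfolding Let_def h1 mult.assoc[of "16 ^ _"] shape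
    by (simp add: dirichlet_beta_3 add_ac)
  show "(\<lambda>i. let k = Suc i in
      16 ^ k * ((6 * real k - 1) * (2 * harm (4 * k - 1) - harm (2 * k - 1))
                + 8 * real k / (2 * real k - 1))
      / ((2 * real k - 1) * real k ^ 2 * real ((2 * k) choose k) * real ((4 * k) choose (2 * k))))
      sums (pi ^ 3)"
  proof -
    have "((6 * real (Suc i) - 1) * h + 8 * real (Suc i) / (2 * real (Suc i) - 1)) / (2 * real i + 1)
        = (6 * real i + 5) / (2 * real i + 1) * h + 8 * (real i + 1) / (2 * real i + 1) ^ 2"
      for i :: nat and h :: real
      by (simp add: divide_simps add_ac) (simp add: power2_eq_square algebra_simps)
    thus ?thesis
      using weight2_sums unfolding Let_def h2 shape by (simp only: dirichlet_beta_3) simp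
  qed
  have "((6 * real (Suc i) - 1) * gen_harm 2 (Suc i - 1)
        - 8 * (4 * real (Suc i) - 1) / (2 * real (Suc i) - 1) ^ 2) / (2 * real i + 1)
      = - (8 * (4 * real i + 3) / (2 * real i + 1) ^ 3
        - (6 * real i + 5) / (2 * real i + 1) * gen_harm 2 i)" for i
    by (simp add: diff_divide_distrib power2_eq_square power3_eq_cube add_ac)
  thus "(\<lambda>i. let k = Suc i in
      16 ^ k * ((6 * real k - 1) * gen_harm 2 (k - 1)
                - 8 * (4 * real k - 1) / (2 * real k - 1) ^ 2)
      / ((2 * real k - 1) * real k ^ 2 * real ((2 * k) choose k) * real ((4 * k) choose (2 * k))))
      sums (- 32 * dirichlet_beta 4)"
    using sums_minus[OF weight3_sums] unfolding Let_def shape by (simp only: mult_minus_left mult_minus_right)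
qed

end
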